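(* Any algorithm that PAC learns all XOS functions from $\{0,1\}^n$ to $[0,1]$ over the uniform distribution with $\ell_1$ error $\epsilon>0$ requires $2^{\Omega(1/\epsilon)}$ random examples of (or value queries to) the target function.
   Context: $f$ is XOS if $f(x)=\max_{c\in C}\sum_{i=1}^n w_{ci}x_i$ for a nonempty finite set $C$ and weights $w_{ci}\ge0$. An algorithm PAC learns a class $\mathcal{F}$ with $\ell_1$ error $\epsilon$ over the uniform distribution if for every target $f\in\mathcal{F}$, given independent examples $(x,f(x))$ with $x$ uniform on $\{0,1\}^n$, with probability at least $2/3$ it outputs $h$ with $\mathbb{E}_x|f(x)-h(x)|\le\epsilon$. A value query returns $f(x)$ for a point $x$ chosen by the algorithm. *)

theory Defs
  imports "HOL-Probability.Probability"
begin

type_synonym point = "nat \<Rightarrow> real"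

definition cube :: "nat \<Rightarrow> point set" where
  "cube n = {..<n} \<rightarrow>\<^sub>E {0, 1}"

definition is_xos :: "nat \<Rightarrow> (point \<Rightarrow> real) \<Rightarrow> bool" where
  "is_xos n f \<longleftrightarrow> (\<exists>(C :: nat set) (w :: nat \<Rightarrow> nat \<Rightarrow> real).
     finite C \<and> C \<noteq> {} \<and> (\<forall>c\<in>C. \<forall>i<n. 0 \<le> w c i) \<and>
     (\<forall>x\<in>cube n. f x = Max ((\<lambda>c. \<Sum>i<n. w c i * x i) ` C)))"

text \<open>Targets are extensional: they take the fixed value \<^const>\<open>undefined\<close> off the cube, so a
  value query at a point outside the cube conveys no information about the target.\<close>

definition xos_class :: "nat \<Rightarrow> (point \<Rightarrow> real) set" where
  "xos_class n = {f \<in> cube n \<rightarrow>\<^sub>E {0..1}. is_xos n f}"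

text \<open>A randomized, adaptive learning algorithm, without any restriction on its running time. It
  may output a hypothesis (an arbitrary real function), draw internal randomness, request a labelled
  example \<open>(x, f x)\<close> with \<open>x\<close> uniform on the cube, or make a value query at a point of its choice; the
  continuation receives the outcome. Algorithms using only random examples or only value queries are
  those in which the other constructor does not occur.\<close>

datatype algorithm =
    Output "point \<Rightarrow> real"
  | Random "nat pmf" "nat \<Rightarrow> algorithm"
  | Example "point \<times> real \<Rightarrow> algorithm"
  | Query point "real \<Rightarrow> algorithm"

text \<open>The joint distribution of the output hypothesis and of the total number of random examples and
  value queries used on target \<open>f\<close>.\<close>

primrec run :: "nat \<Rightarrow> (point \<Rightarrow> real) \<Rightarrow> algorithm \<Rightarrow> ((point \<Rightarrow> real) \<times> nat) pmf" where
  "run n f (Output h) = return_pmf (h, 0)"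
| "run n f (Random p k) = bind_pmf p (\<lambda>r. run n f (k r))"
| "run n f (Example k) =
     bind_pmf (pmf_of_set (cube n)) (\<lambda>x. map_pmf (apsnd Suc) (run n f (k (x, f x))))"
| "run n f (Query x k) = map_pmf (apsnd Suc) (run n f (k (f x)))"

definition l1_error :: "nat \<Rightarrow> (point \<Rightarrow> real) \<Rightarrow> (point \<Rightarrow> real) \<Rightarrow> real" where
  "l1_error n f h = measure_pmf.expectation (pmf_of_set (cube n)) (\<lambda>x. \<bar>f x - h x\<bar>)"

definition pac_learns :: "nat \<Rightarrow> (point \<Rightarrow> real) set \<Rightarrow> real \<Rightarrow> algorithm \<Rightarrow> bool" where
  "pac_learns n F \<epsilon> A \<longleftrightarrow>
     (\<forall>f\<in>F. measure_pmf.prob (run n f A) {(h, q). l1_error n f h \<le> \<epsilon>} \<ge> 2 / 3)"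

text \<open>Worst case over targets in the class and over all randomness.\<close>

definition uses_at_most :: "nat \<Rightarrow> (point \<Rightarrow> real) set \<Rightarrow> nat \<Rightarrow> algorithm \<Rightarrow> bool" where
  "uses_at_most n F m A \<longleftrightarrow> (\<forall>f\<in>F. \<forall>(h, q)\<in>set_pmf (run n f A). q \<le> m)"

end

theory Submission
  imports Defs
begin

text \<open>Let \<open>k\<close> be a small multiple of \<open>1 / \<epsilon>\<close> and let \<open>S\<close> be the support of \<open>x\<close> among the first \<open>k\<close>
  coordinates.  For an arbitrary family \<open>b\<close> of subsets of \<open>{..<k}\<close> the function
  \<open>|S| (3k - |S| + [S \<in> b]) / (3k\<^sup>2)\<close> is monotone in \<open>S\<close> while its quotient by \<open>|S|\<close> is antitone, so
  putting equal weights on the elements of each set exhibits it as XOS.  The bit \<open>[S \<in> b]\<close> changes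
  its value by \<open>|S| / (3k\<^sup>2)\<close>, on average \<open>1 / (6k)\<close>.  Each query or example reveals at most one of
  the \<open>2\<^sup>k\<close> bits, and flipping all unseen bits moves the target by more than \<open>2\<epsilon>\<close> unless a constant
  fraction of them has been seen; hence an algorithm with too few queries succeeds with probability
  at most \<open>1/2\<close> on average over \<open>b\<close>.\<close>

section \<open>Probabilities of mixtures and the l1 distance on the cube\<close>

lemma prob_bind_pmf:
  "measure_pmf.prob (bind_pmf p g) E = measure_pmf.expectation p (\<lambda>r. measure_pmf.prob (g r) E)"
proof -
  have "ennreal (measure_pmf.prob (bind_pmf p g) E)
      = (\<integral>\<^sup>+ r. ennreal (measure_pmf.prob (g r) E) \<partial>p)"
    by (simp flip: measure_pmf.emeasure_eq_measure)
  also have "\<dots> = ennreal (measure_pmf.expectation p (\<lambda>r. measure_pmf.prob (g r) E))"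
    by (intro nn_integral_eq_integral measure_pmf.integrable_const_bound[where B = 1]) auto
  finally show ?thesis
    by (simp add: integral_nonneg_AE)
qed

text \<open>The same \<open>p\<close> serves every \<open>b\<close>, so the finite sum moves inside
  the expectation and a bound for each outcome \<open>r\<close> suffices.\<close>

lemma sum_prob_bind_pmf_le:
  assumes "\<And>r. r \<in> set_pmf p \<Longrightarrow> (\<Sum>b\<in>B. measure_pmf.prob (g b r) (E b)) \<le> c"
  shows "(\<Sum>b\<in>B. measure_pmf.prob (bind_pmf p (g b)) (E b)) \<le> c"
proof -
  have int: "integrable (measure_pmf p) (\<lambda>r. measure_pmf.prob (g b r) (E b))" for b
    by (intro measure_pmf.integrable_const_bound[where B = 1]) auto
  have "(\<Sum>b\<in>B. measure_pmf.prob (bind_pmf p (g b)) (E b))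
      = measure_pmf.expectation p (\<lambda>r. \<Sum>b\<in>B. measure_pmf.prob (g b r) (E b))"
    using int by (simp add: prob_bind_pmf)
  also have "\<dots> \<le> c"
    using assms int by (intro measure_pmf.integral_le_const) (auto simp: AE_measure_pmf_iff)
  finally show ?thesis .
qed

lemma finite_cube [simp]: "finite (cube n)"
  by (simp add: cube_def finite_PiE)

lemma cube_nonempty [simp]: "cube n \<noteq> {}"
  by (simp add: cube_def PiE_eq_empty_iff)

lemma card_cube: "card (cube n) = 2 ^ n"
  by (simp add: cube_def card_PiE numeral_2_eq_2)

lemma l1_error_eq: "l1_error n f h = (\<Sum>x\<in>cube n. \<bar>f x - h x\<bar>) / 2 ^ n"
  by (simp add: l1_error_def integral_pmf_of_set card_cube)

lemma l1_error_triangle: "l1_error n f g \<le> l1_error n f h + l1_error n g h"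
proof -
  have "(\<Sum>x\<in>cube n. \<bar>f x - g x\<bar>) \<le> (\<Sum>x\<in>cube n. \<bar>f x - h x\<bar> + \<bar>g x - h x\<bar>)"
    by (rule sum_mono) linarith
  then show ?thesis
    by (simp add: l1_error_eq sum.distrib divide_right_mono flip: add_divide_distrib)
qed

section \<open>Averaging over targets whose unseen bits are free\<close>

definition flip_closed :: "'a set \<Rightarrow> 'a set \<Rightarrow> 'a set set \<Rightarrow> bool" where
  "flip_closed P Q B \<longleftrightarrow> B \<subseteq> Pow P \<and> (\<forall>b\<in>B. \<forall>D. D \<subseteq> P - Q \<longrightarrow> sym_diff b D \<in> B)"

text \<open>Flips off \<open>insert s Q\<close> leave the bit at \<open>s\<close> alone, so each
  half of \<open>B\<close> is again a union of cosets of the remaining free flips.\<close>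

lemma flip_closed_split:
  assumes "flip_closed P Q B"
  shows "flip_closed P (insert s Q) {b \<in> B. s \<in> b \<longleftrightarrow> v}"
proof -
  have "sym_diff b D \<in> B" "s \<in> sym_diff b D \<longleftrightarrow> s \<in> b" if "b \<in> B" "D \<subseteq> P - insert s Q" for b D
    using assms that unfolding flip_closed_def by blast+
  then show ?thesis
    using assms unfolding flip_closed_def by blast
qed

text \<open>The answer at \<open>x\<close> depends only on the bit at \<open>s\<close>. Splitting
  \<open>B\<close> by that bit makes the answer, and hence the continuation, constant on each half;
  there \<open>step\<close> applies with \<open>s\<close> added to \<open>Q\<close> and the budget
  lowered by one, which keeps \<open>card Q + m\<close> within \<open>M\<close>.\<close>

lemma average_success_query:
  fixes F :: "'a set \<Rightarrow> point \<Rightarrow> real"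
  assumes "finite P" and local: "\<And>b b'. s \<in> b \<longleftrightarrow> s \<in> b' \<Longrightarrow> F b x = F b' x"
    and step: "\<And>y B Q m. flip_closed P Q B \<Longrightarrow> finite Q \<Longrightarrow> card Q + m \<le> M \<Longrightarrow>
      (\<Sum>b\<in>B. measure_pmf.prob (run n (F b) (k y)) {(h, q). l1_error n (F b) h \<le> \<epsilon> \<and> q \<le> m})
        \<le> real (card B) / 2"
    and B: "flip_closed P Q B" and Q: "finite Q" "card Q + m \<le> M"
  shows "(\<Sum>b\<in>B. measure_pmf.prob (map_pmf (apsnd Suc) (run n (F b) (k (F b x))))
            {(h, q). l1_error n (F b) h \<le> \<epsilon> \<and> q \<le> m}) \<le> real (card B) / 2"
proof (cases m)
  case 0
  \<comment> \<open>With no budget left, the query just made already violates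
    \<open>q \<le> m\<close>.\<close>
  have "apsnd Suc -` {(h, q). R h \<and> q \<le> m} = {}" for R :: "(point \<Rightarrow> real) \<Rightarrow> bool"
    using 0 by auto
  then show ?thesis
    by simp
next
  case (Suc m')
  let ?p = "\<lambda>b y. measure_pmf.prob (run n (F b) (k y)) {(h, q). l1_error n (F b) h \<le> \<epsilon> \<and> q \<le> m'}"
  let ?B = "\<lambda>v. {b \<in> B. s \<in> b \<longleftrightarrow> v}"
  have vimage: "apsnd Suc -` {(h, q). R h \<and> q \<le> m} = {(h, q). R h \<and> q \<le> m'}"
    for R :: "(point \<Rightarrow> real) \<Rightarrow> bool"
    using Suc by auto
  have "finite B"
    using B \<open>finite P\<close> by (auto simp: flip_closed_def intro: finite_subset)
  then have fin: "finite (?B v)" for v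
    by simp
  have disj: "?B True \<inter> ?B False = {}" and un: "B = ?B True \<union> ?B False"
    by auto
  have half: "(\<Sum>b\<in>?B v. ?p b (F b x)) \<le> real (card (?B v)) / 2" for v
  proof -
    \<comment> \<open>\<open>{z. v}\<close> is the full or the empty set: a representative with the
      prescribed bit at \<open>s\<close>.\<close>
    define y where "y = F {z. v} x"
    have y: "F b x = y" if "b \<in> ?B v" for b
      unfolding y_def using that by (intro local) simp
    have "(\<Sum>b\<in>?B v. ?p b (F b x)) = (\<Sum>b\<in>?B v. ?p b y)"
      using y by (intro sum.cong) auto
    also have "\<dots> \<le> real (card (?B v)) / 2"
      using Q Suc by (intro step[OF flip_closed_split[OF B]]) (auto simp: card_insert_if)
    finally show ?thesis .
  qed
  have "(\<Sum>b\<in>B. ?p b (F b x)) = (\<Sum>b\<in>?B True. ?p b (F b x)) + (\<Sum>b\<in>?B False. ?p b (F b x))"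
    by (subst un, rule sum.union_disjoint[OF fin fin disj])
  also have "\<dots> \<le> real (card (?B True)) / 2 + real (card (?B False)) / 2"
    by (intro add_mono half)
  also have "\<dots> = real (card B) / 2"
    using card_Un_disjoint[OF fin fin disj] un by simp
  finally show ?thesis
    unfolding measure_map_pmf vimage .
qed

text \<open>The set \<open>Q\<close> collects the indices of the points seen so far, and \<open>B\<close> the targets compatible
  with the answers.  Once the algorithm stops, a hypothesis cannot be close both to \<open>F b\<close> and to
  \<open>F\<close> of the complement of \<open>b\<close> off \<open>Q\<close>, so it succeeds on at most half of \<open>B\<close>.\<close>

lemma average_success_le_half:
  fixes F :: "'a set \<Rightarrow> point \<Rightarrow> real" and key :: "point \<Rightarrow> 'a"
  assumes "finite P"
    and local: "\<And>x b b'. key x \<in> b \<longleftrightarrow> key x \<in> b' \<Longrightarrow> F b x = F b' x"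
    and sep: "\<And>b Q. finite Q \<Longrightarrow> card Q \<le> M \<Longrightarrow>
                2 * \<epsilon> < l1_error n (F b) (F (sym_diff b (P - Q)))"
  shows "flip_closed P Q B \<Longrightarrow> finite Q \<Longrightarrow> card Q + m \<le> M \<Longrightarrow>
    (\<Sum>b\<in>B. measure_pmf.prob (run n (F b) A) {(h, q). l1_error n (F b) h \<le> \<epsilon> \<and> q \<le> m})
      \<le> real (card B) / 2"
proof (induction A arbitrary: B Q m)
  case (Output h)
  let ?g = "\<lambda>b. of_bool (l1_error n (F b) h \<le> \<epsilon>) :: real"
  let ?flip = "\<lambda>b. sym_diff b (P - Q)"
  have flip: "?flip b \<in> B" if "b \<in> B" for b
    using Output.prems(1) that by (auto simp: flip_closed_def)
  have flip_flip: "?flip (?flip b) = b" for b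
    by blast
  \<comment> \<open>The flip is an involution of \<open>B\<close>, so twice the number of successes
    is a sum over pairs \<open>b\<close>, \<open>?flip b\<close>, each contributing at most
    1.\<close>
  have "(\<Sum>b\<in>B. ?g b) = (\<Sum>b\<in>B. ?g (?flip b))"
    by (rule sum.reindex_bij_witness[where i = ?flip and j = ?flip]; (rule flip flip_flip)?)
      (simp_all only: flip_flip)
  then have "2 * (\<Sum>b\<in>B. ?g b) = (\<Sum>b\<in>B. ?g b + ?g (?flip b))"
    unfolding sum.distrib by linarith
  also have "\<dots> \<le> (\<Sum>b\<in>B. 1)"
  proof (rule sum_mono)
    fix b
    have "2 * \<epsilon> < l1_error n (F b) (F (?flip b))"
      using Output.prems by (intro sep) auto
    also have "\<dots> \<le> l1_error n (F b) h + l1_error n (F (?flip b)) h"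
      by (rule l1_error_triangle)
    finally show "?g b + ?g (?flip b) \<le> 1"
      by (auto simp: of_bool_def)
  qed
  finally show ?case
    by (simp add: indicator_def of_bool_def)
next
  case (Random p k)
  show ?case
    unfolding run.simps
    by (rule sum_prob_bind_pmf_le) (use Random in blast)
next
  case (Example k)
  show ?case
    unfolding run.simps
  proof (rule sum_prob_bind_pmf_le)
    \<comment> \<open>The law of \<open>x\<close> does not depend on the target; once
      \<open>x\<close> is fixed, an example acts like a value query at \<open>x\<close>.\<close>
    fix x
    show "(\<Sum>b\<in>B. measure_pmf.prob (map_pmf (apsnd Suc) (run n (F b) (k (x, F b x))))
            {(h, q). l1_error n (F b) h \<le> \<epsilon> \<and> q \<le> m}) \<le> real (card B) / 2"
      by (rule average_success_query[where k = "\<lambda>y. k (x, y)" and s = "key x" and F = F and x = x, OF \<open>finite P\<close> local _ Example.prems])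
        (assumption | rule Example.IH[OF rangeI])+
  qed
next
  case (Query x k)
  show ?case
    unfolding run.simps
    by (rule average_success_query[where s = "key x" and F = F and x = x, OF \<open>finite P\<close> local _ Query.prems]) (assumption | rule Query.IH[OF rangeI])+
qed

section \<open>The hard family and its XOS representation\<close>

definition supp :: "nat \<Rightarrow> point \<Rightarrow> nat set" where
  "supp k x = {i. i < k \<and> x i = 1}"

definition slope :: "nat \<Rightarrow> nat set set \<Rightarrow> nat set \<Rightarrow> real" where
  "slope k b S = (3 * real k - real (card S) + of_bool (S \<in> b)) / (3 * real k ^ 2)"

definition target :: "nat \<Rightarrow> nat \<Rightarrow> nat set set \<Rightarrow> point \<Rightarrow> real" where
  "target n k b = (\<lambda>x\<in>cube n. real (card (supp k x)) * slope k b (supp k x))"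

lemma supp_subset: "supp k x \<subseteq> {..<k}"
  by (auto simp: supp_def)

lemma finite_supp [simp]: "finite (supp k x)"
  by (rule finite_subset[OF supp_subset]) simp

text \<open>Each added element lowers the numerator by one, which a single bit can at best
  cancel.\<close>

lemma slope_antimono:
  assumes "finite T" "U \<subseteq> T"
  shows "slope k b T \<le> slope k b U"
proof (cases "U = T")
  case False
  then have "card U < card T"
    using assms by (simp add: psubset_card_mono psubsetI)
  then show ?thesis
    unfolding slope_def by (intro divide_right_mono) (auto simp: of_bool_def)
qed simp

lemma card_slope_mono:
  assumes "U \<subseteq> S" "S \<subseteq> {..<k}"
  shows "real (card U) * slope k b U \<le> real (card S) * slope k b S"
proof (cases "U = S")
  case False
  have fin: "finite S"
    using assms(2) finite_subset by blast
  define u s where "u = real (card U)" and "s = real (card S)"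
  have us: "u + 1 \<le> s"
    using psubset_card_mono[OF fin psubsetI[OF assms(1) False]] unfolding u_def s_def by linarith
  have sk: "s \<le> k"
    using card_mono[OF _ assms(2)] unfolding s_def by simp
  have u0: "0 \<le> u"
    unfolding u_def by simp
  \<comment> \<open>The right side is \<open>s * (3k - s) - u * (3k - u)\<close>. Since
    \<open>s + u \<le> 2k\<close>, it is at least \<open>k\<close>, hence at least \<open>u\<close>,
    the most that the bit of \<open>U\<close> can add.\<close>
  have "real k * 1 \<le> (3 * real k - s - u) * (s - u)"
    using us sk u0 by (intro mult_mono) auto
  then have "u * (3 * real k - u + 1) \<le> s * (3 * real k - s)"
    using us sk by (simp add: algebra_simps)
  moreover have "u * (3 * real k - u + of_bool (U \<in> b)) \<le> u * (3 * real k - u + 1)"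
    using u0 by (intro mult_left_mono) auto
  moreover have "s * (3 * real k - s) \<le> s * (3 * real k - s + of_bool (S \<in> b))"
    using us u0 by (intro mult_left_mono) auto
  ultimately show ?thesis
    unfolding slope_def times_divide_eq_right u_def[symmetric] s_def[symmetric]
    by (intro divide_right_mono) auto
qed simp

lemma slope_nonneg:
  assumes "S \<subseteq> {..<k}"
  shows "0 \<le> slope k b S"
  using card_mono[OF _ assms] by (auto simp: slope_def intro!: divide_nonneg_nonneg)

lemma card_slope_le_1:
  assumes "S \<subseteq> {..<k}"
  shows "real (card S) * slope k b S \<le> 1"
proof (cases "k = 0")
  case False
  have "real (card S) * slope k b S \<le> real (card {..<k}) * slope k b {..<k}"
    using assms by (intro card_slope_mono) auto
  also have "\<dots> \<le> 1"
    using False by (auto simp: slope_def divide_simps power2_eq_square of_bool_def algebra_simps)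
  finally show ?thesis .
qed (use assms in simp)

lemma sum_mult_cube:
  assumes x: "x \<in> cube n" and "k \<le> n" "T \<subseteq> {..<k}"
  shows "(\<Sum>i<n. (if i \<in> T then a else 0) * x i) = a * real (card (T \<inter> supp k x))"
proof -
  have "(\<Sum>i<n. (if i \<in> T then a else 0) * x i) = (\<Sum>i<n. if i \<in> T \<inter> supp k x then a else 0)"
    using x assms(3) by (intro sum.cong) (auto simp: cube_def supp_def PiE_iff)
  also have "\<dots> = (\<Sum>i\<in>T \<inter> supp k x. a)"
    using assms by (intro sum.mono_neutral_cong_right) auto
  finally show ?thesis
    by simp
qed

text \<open>The clause of \<open>T\<close> puts weight \<open>slope k b T\<close> on the elements of
  \<open>T\<close>. At a point with support \<open>S\<close>, antitonicity of the slope replaces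
  \<open>T\<close> by its intersection with \<open>S\<close>, and monotonicity then replaces that by
  \<open>S\<close>; the clause of \<open>S\<close> attains the bound.\<close>

lemma target_in_xos_class:
  assumes "k \<le> n"
  shows "target n k b \<in> xos_class n"
proof -
  \<comment> \<open>Clauses are indexed by natural numbers, so subsets are coded by
    \<open>set_encode\<close>.\<close>
  define C where "C = set_encode ` Pow {..<k}"
  define w where "w c i = (if i \<in> set_decode c then slope k b (set_decode c) else 0)" for c i
  have dec: "set_decode c \<subseteq> {..<k}" if "c \<in> C" for c
    using that by (auto simp: C_def set_encode_inverse[OF finite_subset[OF _ finite_lessThan]] subset_iff)
  have "target n k b x = Max ((\<lambda>c. \<Sum>i<n. w c i * x i) ` C)" if x: "x \<in> cube n" for x
  proof (rule Max_eqI[symmetric])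
    show "finite ((\<lambda>c. \<Sum>i<n. w c i * x i) ` C)"
      by (simp add: C_def)
    have sum: "(\<Sum>i<n. w c i * x i) = slope k b (set_decode c) * real (card (set_decode c \<inter> supp k x))"
      if "c \<in> C" for c
      unfolding w_def by (rule sum_mult_cube[OF x assms dec[OF that]])
    show "y \<le> target n k b x" if y_in: "y \<in> (\<lambda>c. \<Sum>i<n. w c i * x i) ` C" for y
    proof -
      obtain c where c: "c \<in> C" and y: "y = (\<Sum>i<n. w c i * x i)"
        using y_in by blast
      let ?U = "set_decode c \<inter> supp k x"
      have "y \<le> slope k b ?U * real (card ?U)"
        unfolding y sum[OF c]
        by (intro mult_right_mono slope_antimono) auto
      also have "\<dots> \<le> real (card (supp k x)) * slope k b (supp k x)"
        using card_slope_mono[of ?U "supp k x" k b] supp_subset by (simp add: mult.commute)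
      finally show ?thesis
        using x by (simp add: target_def)
    qed
    have "set_encode (supp k x) \<in> C"
      using supp_subset by (auto simp: C_def)
    from imageI[OF this, of "\<lambda>c. \<Sum>i<n. w c i * x i"]
    show "target n k b x \<in> (\<lambda>c. \<Sum>i<n. w c i * x i) ` C"
      using x sum[OF \<open>set_encode (supp k x) \<in> C\<close>]
      by (simp add: target_def set_encode_inverse mult.commute)
  qed
  moreover have "\<forall>c\<in>C. \<forall>i<n. 0 \<le> w c i"
    using dec slope_nonneg by (auto simp: w_def)
  moreover have "finite C" "C \<noteq> {}"
    by (auto simp: C_def)
  ultimately have "is_xos n (target n k b)"
    unfolding is_xos_def by blast
  moreover have "target n k b \<in> cube n \<rightarrow>\<^sub>E {0..1}"
    using card_slope_le_1[OF supp_subset] slope_nonneg[OF supp_subset]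
    by (auto simp: target_def)
  ultimately show ?thesis
    by (simp add: xos_class_def)
qed

section \<open>The distance between a target and its flip off \<open>Q\<close>\<close>

lemma sum_cube_coordinate:
  assumes "i < n"
  shows "(\<Sum>x\<in>cube n. x i) = 2 ^ n / 2"
proof -
  let ?flip = "\<lambda>x :: point. x(i := 1 - x i)"
  have "(\<Sum>x\<in>cube n. x i) = (\<Sum>x\<in>cube n. 1 - x i)"
    by (rule sum.reindex_bij_witness[where i = ?flip and j = ?flip])
      (use assms in \<open>auto simp: cube_def PiE_iff extensional_def\<close>)
  then show ?thesis
    by (simp add: sum_subtractf card_cube)
qed

lemma card_supp_eq:
  assumes "x \<in> cube n" "k \<le> n"
  shows "real (card (supp k x)) = (\<Sum>i<k. x i)"
proof -
  have "(\<Sum>i<k. x i) = (\<Sum>i\<in>supp k x. 1)"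
    using assms by (intro sum.mono_neutral_cong_right) (auto simp: supp_def cube_def PiE_iff)
  then show ?thesis
    by simp
qed

text \<open>A point of the fibre is determined by its last \<open>n - k\<close> coordinates.\<close>

lemma card_supp_fibre_le:
  assumes "k \<le> n"
  shows "card {x \<in> cube n. supp k x = S} \<le> 2 ^ (n - k)"
proof -
  let ?X = "{x \<in> cube n. supp k x = S}"
  have "inj_on (\<lambda>x. restrict x {k..<n}) ?X"
  proof (rule inj_onI, rule ext)
    fix x y i
    assume x: "x \<in> ?X" and y: "y \<in> ?X" and eq: "restrict x {k..<n} = restrict y {k..<n}"
    consider "i < k" | "k \<le> i" "i < n" | "n \<le> i"
      by linarith
    then show "x i = y i"
    proof cases
      case 1
      then have "x i = 1 \<longleftrightarrow> y i = 1"
        using x y by (auto simp: supp_def)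
      moreover have "x i \<in> {0, 1}" "y i \<in> {0, 1}"
        using x y 1 assms by (auto simp: cube_def dest: PiE_mem)
      ultimately show ?thesis
        by auto
    next
      case 2
      then show ?thesis
        using fun_cong[OF eq, of i] by simp
    next
      case 3
      then show ?thesis
        using x y by (auto simp: cube_def PiE_iff extensional_def)
    qed
  qed
  moreover have "(\<lambda>x. restrict x {k..<n}) ` ?X \<subseteq> {k..<n} \<rightarrow>\<^sub>E {0, 1}"
    by (auto simp: cube_def PiE_iff)
  ultimately have "card ?X \<le> card ({k..<n} \<rightarrow>\<^sub>E {0, 1 :: real})"
    by (rule card_inj_on_le) (simp add: finite_PiE)
  then show ?thesis
    by (simp add: card_PiE numeral_2_eq_2)
qed

lemma card_supp_in_le:
  assumes "k \<le> n" "finite Q"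
  shows "card {x \<in> cube n. supp k x \<in> Q} \<le> card Q * 2 ^ (n - k)"
proof -
  have "{x \<in> cube n. supp k x \<in> Q} = (\<Union>S\<in>Q. {x \<in> cube n. supp k x = S})"
    by blast
  also have "card \<dots> \<le> (\<Sum>S\<in>Q. card {x \<in> cube n. supp k x = S})"
    by (rule card_UN_le[OF assms(2)])
  also have "\<dots> \<le> (\<Sum>S\<in>Q. 2 ^ (n - k))"
    by (intro sum_mono card_supp_fibre_le assms)
  finally show ?thesis
    by simp
qed

text \<open>The mean support size \<open>k / 2\<close> would give distance \<open>1 / (6k)\<close>
  if every bit were flipped. Points with support in \<open>Q\<close> form at most a fraction
  \<open>card Q / 2^k\<close> of the cube and cost at most \<open>1 / (3k)\<close> each.\<close>

lemma l1_error_target_ge: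
  assumes "k \<le> n" "0 < k" "finite Q"
  shows "(1 / 2 - real (card Q) / 2 ^ k) / (3 * real k)
    \<le> l1_error n (target n k b) (target n k (sym_diff b (Pow {..<k} - Q)))"
proof -
  \<comment> \<open>A pointwise lower bound that is easy to sum: exact off \<open>Q\<close>, and
    nonpositive on \<open>Q\<close> because the support has at most \<open>k\<close>
    elements.\<close>
  let ?d = "\<lambda>x. ((\<Sum>i<k. x i) - real k * of_bool (supp k x \<in> Q)) / (3 * real k ^ 2)"
  let ?b' = "sym_diff b (Pow {..<k} - Q)"
  have pt: "?d x \<le> \<bar>target n k b x - target n k ?b' x\<bar>" if x: "x \<in> cube n" for x
  proof (cases "supp k x \<in> Q")
    case True
    have "(\<Sum>i<k. x i) \<le> real k"
      using card_mono[OF _ supp_subset, of k x] card_supp_eq[OF x assms(1)] by simp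
    then have "?d x \<le> 0"
      using True by (simp add: divide_nonpos_nonneg)
    then show ?thesis
      by linarith
  next
    case False
    then have "supp k x \<in> ?b' \<longleftrightarrow> supp k x \<notin> b"
      using supp_subset by auto
    then show ?thesis
      using False x by (auto simp: target_def slope_def card_supp_eq[OF x assms(1), symmetric]
          abs_mult simp flip: right_diff_distrib diff_divide_distrib)
  qed
  have "(\<Sum>x\<in>cube n. \<Sum>i<k. x i) = (\<Sum>i<k. \<Sum>x\<in>cube n. x i)"
    by (rule sum.swap)
  also have "\<dots> = real k * (2 ^ n / 2)"
    using assms(1) by (simp add: sum_cube_coordinate)
  finally have s1: "(\<Sum>x\<in>cube n. \<Sum>i<k. x i) = real k * (2 ^ n / 2)" .
  have "(\<Sum>x\<in>cube n. of_bool (supp k x \<in> Q) :: real) = real (card {x \<in> cube n. supp k x \<in> Q})"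
    by (simp add: of_bool_def sum.If_cases Int_def)
  also have "\<dots> \<le> real (card Q * 2 ^ (n - k))"
    using card_supp_in_le[OF assms(1,3)] by (rule of_nat_mono)
  also have "\<dots> = real (card Q) * 2 ^ n / 2 ^ k"
    using power_add[of "2 :: real" k "n - k"] assms(1) by simp
  finally have s2: "(\<Sum>x\<in>cube n. of_bool (supp k x \<in> Q) :: real) \<le> real (card Q) * 2 ^ n / 2 ^ k" .
  have "(1 / 2 - real (card Q) / 2 ^ k) / (3 * real k)
      = (real k * (2 ^ n / 2) - real k * (real (card Q) * 2 ^ n / 2 ^ k)) / (3 * real k ^ 2) / 2 ^ n"
    using assms(2) by (simp add: field_simps power2_eq_square)
  also have "\<dots> \<le> ((\<Sum>x\<in>cube n. \<Sum>i<k. x i) - real k * (\<Sum>x\<in>cube n. of_bool (supp k x \<in> Q)))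
      / (3 * real k ^ 2) / 2 ^ n"
    unfolding s1 by (intro divide_right_mono diff_left_mono mult_left_mono s2) auto
  also have "\<dots> = (\<Sum>x\<in>cube n. ?d x) / 2 ^ n"
    by (simp add: sum_subtractf sum_distrib_left flip: sum_divide_distrib)
  also have "\<dots> \<le> l1_error n (target n k b) (target n k ?b')"
    unfolding l1_error_eq by (intro divide_right_mono sum_mono pt) auto
  finally show ?thesis .
qed

theorem theorem6p10:
  "\<exists>c > 0. \<exists>\<epsilon>\<^sub>0 > 0. \<forall>\<epsilon>::real. 0 < \<epsilon> \<and> \<epsilon> \<le> \<epsilon>\<^sub>0 \<longrightarrow>
     (\<exists>n\<^sub>0. \<forall>n \<ge> n\<^sub>0. \<forall>A m.
        pac_learns n (xos_class n) \<epsilon> A \<and> uses_at_most n (xos_class n) m A \<longrightarrow>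
        2 powr (c / \<epsilon>) \<le> real m)"
proof (rule exI[of _ "1 / 96"], rule conjI, simp, rule exI[of _ "1 / 288"], intro conjI allI impI)
  fix \<epsilon> :: real
  assume \<epsilon>: "0 < \<epsilon> \<and> \<epsilon> \<le> 1 / 288"
  \<comment> \<open>The factor 48 gives \<open>1 / (12k) \<ge> 4\<epsilon>\<close>, enough for
    separation while at most a quarter of the bits is seen. The bound 1/288 makes
    \<open>1 / (48\<epsilon>) \<ge> 6\<close>, whence \<open>k - 2 \<ge> 1 / (96\<epsilon>)\<close>;
    the 2 absorbs that quarter.\<close>
  define k where "k = nat \<lfloor>1 / (48 * \<epsilon>)\<rfloor>"
  have "6 \<le> 1 / (48 * \<epsilon>)"
    using \<epsilon> by (simp add: field_simps)
  then have k: "real k \<le> 1 / (48 * \<epsilon>)" "1 / (48 * \<epsilon>) < real k + 1" "0 < k"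
    unfolding k_def by linarith+
  show "\<exists>n\<^sub>0. \<forall>n\<ge>n\<^sub>0. \<forall>A m. pac_learns n (xos_class n) \<epsilon> A \<and> uses_at_most n (xos_class n) m A
      \<longrightarrow> 2 powr (1 / 96 / \<epsilon>) \<le> real m"
  proof (intro exI[of _ k] allI impI; elim conjE)
    fix n A m
    assume "k \<le> n" and pac: "pac_learns n (xos_class n) \<epsilon> A"
      and uses: "uses_at_most n (xos_class n) m A"
    note target = target_in_xos_class[OF \<open>k \<le> n\<close>]
    let ?P = "Pow {..<k}"
    let ?F = "target n k"
    let ?success = "\<lambda>b. measure_pmf.prob (run n (?F b) A)
      {(h, q). l1_error n (?F b) h \<le> \<epsilon> \<and> q \<le> m}"
    show "2 powr (1 / 96 / \<epsilon>) \<le> real m"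
    proof (rule ccontr)
      assume "\<not> 2 powr (1 / 96 / \<epsilon>) \<le> real m"
      then have "real m < 2 powr (1 / 96 / \<epsilon>)"
        by simp
      also have "\<dots> \<le> 2 powr (real k - 2)"
        using k(2) \<open>6 \<le> 1 / (48 * \<epsilon>)\<close> by (intro powr_mono) (auto simp: field_simps)
      also have "\<dots> = 2 ^ k / 4"
        by (simp add: powr_diff powr_realpow)
      finally have m: "real m < 2 ^ k / 4" .
      have sep: "2 * \<epsilon> < l1_error n (?F b) (?F (sym_diff b (?P - Q)))"
        if "finite Q" "card Q \<le> m" for b Q
      proof -
        have "2 * \<epsilon> < (1 / 4) / (3 * real k)"
          using k \<epsilon> by (simp add: field_simps)
        also have "\<dots> \<le> (1 / 2 - real (card Q) / 2 ^ k) / (3 * real k)"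
          using m that(2) by (intro divide_right_mono) (auto simp: field_simps)
        also have "\<dots> \<le> l1_error n (?F b) (?F (sym_diff b (?P - Q)))"
          by (rule l1_error_target_ge[OF \<open>k \<le> n\<close> \<open>0 < k\<close> that(1)])
        finally show ?thesis .
      qed
      have local: "?F b x = ?F b' x" if "supp k x \<in> b \<longleftrightarrow> supp k x \<in> b'" for x b b'
        using that by (simp add: target_def slope_def restrict_def)
      have "2 / 3 \<le> ?success b" for b
      proof -
        have "2 / 3 \<le> measure_pmf.prob (run n (?F b) A) {(h, q). l1_error n (?F b) h \<le> \<epsilon>}"
          using pac target by (simp add: pac_learns_def)
        \<comment> \<open>The query bound holds almost surely, so adding \<open>q \<le> m\<close> to
          the event loses no probability.\<close>
        also have "\<dots> \<le> ?success b"
          using uses target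
          by (intro measure_pmf.finite_measure_mono_AE)
            (auto simp: AE_measure_pmf_iff uses_at_most_def)
        finally show ?thesis .
      qed
      then have "(\<Sum>b\<in>Pow ?P. 2 / 3) \<le> (\<Sum>b\<in>Pow ?P. ?success b)"
        by (intro sum_mono)
      also have "\<dots> \<le> real (card (Pow ?P)) / 2"
      \<comment> \<open>Initially nothing is seen and all families are possible; an average of at
        most 1/2 contradicts success 2/3 on every target.\<close>
      proof (rule average_success_le_half[where key = "supp k" and P = ?P and Q = "{}" and M = m])
        show "flip_closed ?P {} (Pow ?P)"
          by (auto simp: flip_closed_def)
        show "?F b x = ?F b' x" if "supp k x \<in> b \<longleftrightarrow> supp k x \<in> b'" for x b b'
          using that by (rule local)
        show "2 * \<epsilon> < l1_error n (?F b) (?F (sym_diff b (?P - Q)))"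
          if "finite Q" "card Q \<le> m" for b Q
          using that by (rule sep)
      qed simp_all
      finally show False
        by (simp add: card_Pow)
    qed
  qed
qed auto

end
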